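(* Let $k\ge 2$, let $0=r_0<r_1<\dots<r_k$ be integers, $d=\gcd(r_1,\dots,r_k)$, and let $n$ be a positive integer with $\gcd(n,d)=1$. If $n\ge r_k^4$, then the numerical semigroup $M_n=\langle n,n+r_1,\dots,n+r_k\rangle$ is not almost symmetric of even type.
   Context: $\mathbb{N}$ includes $0$, and $\langle a_1,\dots,a_s\rangle=\{\sum\lambda_i a_i\mid\lambda_i\in\mathbb{N}\}$. For a numerical semigroup $H$ (additive submonoid of $\mathbb{N}$ with finite complement), $\operatorname{F}(H)=\max(\mathbb{Z}\setminus H)$, $\operatorname{PF}(H)=\{x\in\mathbb{Z}\setminus H\mid x+h\in H\ \forall\, 0\neq h\in H\}$, and the type of $H$ is $|\operatorname{PF}(H)|$. Let $K(H)=\{x\in\mathbb{N}\mid\operatorname{F}(H)-x\notin H\}$ and $M(H)=H\setminus\{0\}$. $H$ is almost symmetric if $M(H)+K(H)\subseteq M(H)$. *)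

theory Defs
  imports Complex_Main "HOL-Library.Set_Algebras"
begin

definition numerical_semigroup :: "nat set \<Rightarrow> bool" where
  "numerical_semigroup H \<longleftrightarrow>
     0 \<in> H \<and> (\<forall>x\<in>H. \<forall>y\<in>H. x + y \<in> H) \<and> finite (UNIV - H)"

text \<open>The semigroup generated by a finite set; only meaningful for finite \<open>A\<close>, since
  sums over infinite sets are \<open>0\<close> by convention.\<close>

definition semigroup_gen :: "nat set \<Rightarrow> nat set" where
  "semigroup_gen A = {\<Sum>a\<in>A. l a * a | l :: nat \<Rightarrow> nat. True}"

text \<open>The complement of \<open>H\<close> is taken in the integers, so the Frobenius number of \<open>UNIV\<close>
  is \<open>-1\<close>. That complement is always infinite, so \<open>Max\<close> cannot be used.\<close>

definition frobenius :: "nat set \<Rightarrow> int" where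
  "frobenius H = (GREATEST x. x \<in> UNIV - int ` H)"

definition pseudo_frobenius :: "nat set \<Rightarrow> int set" where
  "pseudo_frobenius H =
     {x \<in> UNIV - int ` H. \<forall>h\<in>H. h \<noteq> 0 \<longrightarrow> x + int h \<in> int ` H}"

definition semigroup_type :: "nat set \<Rightarrow> nat" where
  "semigroup_type H = card (pseudo_frobenius H)"

definition canonical_ideal :: "nat set \<Rightarrow> nat set" where
  "canonical_ideal H = {x. frobenius H - int x \<notin> int ` H}"

definition maximal_ideal :: "nat set \<Rightarrow> nat set" where
  "maximal_ideal H = H - {0}"

text \<open>The sum is the Minkowski sum of sets.\<close>

definition almost_symmetric :: "nat set \<Rightarrow> bool" where
  "almost_symmetric H \<longleftrightarrow> maximal_ideal H + canonical_ideal H \<subseteq> maximal_ideal H"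

definition shifted_semigroup :: "nat \<Rightarrow> (nat \<Rightarrow> nat) \<Rightarrow> nat \<Rightarrow> nat set" where
  "shifted_semigroup k r n = semigroup_gen ((\<lambda>i. n + r i) ` {0..k})"

lemma semigroup_gen_zero: "0 \<in> semigroup_gen A"
  unfolding semigroup_gen_def by (auto intro!: exI[of _ "\<lambda>_. 0"])

lemma semigroup_gen_add:
  assumes "x \<in> semigroup_gen A" "y \<in> semigroup_gen A"
  shows "x + y \<in> semigroup_gen A"
proof -
  obtain l m where "x = (\<Sum>a\<in>A. l a * a)" "y = (\<Sum>a\<in>A. m a * a)"
    using assms unfolding semigroup_gen_def by auto
  then have "x + y = (\<Sum>a\<in>A. (l a + m a) * a)"
    by (simp add: sum.distrib algebra_simps)
  then show ?thesis unfolding semigroup_gen_def by (auto intro!: exI[of _ "\<lambda>a. l a + m a"])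
qed

lemma semigroup_gen_mult:
  assumes "x \<in> semigroup_gen A"
  shows "q * x \<in> semigroup_gen A"
  by (induction q) (auto simp: semigroup_gen_zero semigroup_gen_add assms)

lemma semigroup_gen_mem:
  assumes "finite A" "a \<in> A"
  shows "a \<in> semigroup_gen A"
proof -
  have "(\<Sum>b\<in>A. (if b = a then 1 else 0) * b) = (\<Sum>b\<in>A. if b = a then b else 0)"
    by (intro sum.cong) auto
  also have "\<dots> = a" using assms by (simp add: sum.delta)
  finally have "a = (\<Sum>b\<in>A. (if b = a then 1 else 0) * b)" by simp
  then show ?thesis
    unfolding semigroup_gen_def mem_Collect_eq
    by (intro exI[of _ "\<lambda>b. if b = a then 1 else 0"]) auto
qed

lemma numerical_semigroup_semigroup_gen:
  assumes "finite A" "Gcd A = 1"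
  shows "numerical_semigroup (semigroup_gen A)"
proof -
  let ?H = "semigroup_gen A"
  define P where "P e \<longleftrightarrow> e > 0 \<and> (\<exists>u. u \<in> ?H \<and> u + e \<in> ?H)" for e
  have "\<exists>a\<in>A. a \<noteq> 0"
    using assms(2) by (metis Gcd_0_iff singletonI subsetI subset_singletonD zero_neq_one insertCI)
  then obtain a where "a \<in> A" "a > 0" by auto
  then have "P a" using semigroup_gen_mem[OF assms(1)] semigroup_gen_zero[of A]
    unfolding P_def by (auto intro!: exI[of _ 0])
  then have "P (LEAST e. P e)" by (rule LeastI)
  moreover define e where "e = (LEAST e. P e)"
  ultimately have "P e" by simp
  then obtain u where e: "e > 0" "u \<in> ?H" "u + e \<in> ?H" unfolding P_def by auto
  have "e dvd b" if b: "b \<in> A" for b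
  proof (rule ccontr)
    assume "\<not> e dvd b"
    then have pos: "b mod e > 0" by (simp add: mod_greater_zero_iff_not_dvd)
    have "(b div e) * (u + e) + b mod e = b + (b div e) * u"
      by (simp add: algebra_simps)
    moreover have "b + (b div e) * u \<in> ?H"
      using b by (intro semigroup_gen_add semigroup_gen_mult semigroup_gen_mem e assms)
    moreover have "(b div e) * (u + e) \<in> ?H"
      by (intro semigroup_gen_mult e)
    ultimately have "P (b mod e)" using pos unfolding P_def by metis
    then have "e \<le> b mod e" unfolding e_def by (rule Least_le)
    then show False using mod_less_divisor[OF e(1), of b] by linarith
  qed
  then have "e dvd Gcd A" by (rule Gcd_greatest)
  then have "e = 1" using assms(2) by simp
  then have u: "u \<in> ?H" "u + 1 \<in> ?H" using e by auto
  have "N \<in> ?H" if "N \<ge> u * u" for N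
  proof (cases "u = 0")
    case True
    then show ?thesis using semigroup_gen_mult[OF u(2), of N] by simp
  next
    case False
    have "u \<le> N div u" using div_le_mono[OF that, of u] False by simp
    moreover have "N mod u < u" using False by simp
    ultimately have le: "N mod u \<le> N div u" by linarith
    then obtain t where t: "N div u = N mod u + t" using le_Suc_ex by blast
    have "N = (N div u) * u + N mod u" by simp
    also have "\<dots> = t * u + (N mod u) * (u + 1)" unfolding t by (simp add: algebra_simps)
    finally have "N = t * u + (N mod u) * (u + 1)" .
    moreover have "t * u + (N mod u) * (u + 1) \<in> ?H"
      by (intro semigroup_gen_add semigroup_gen_mult u)
    ultimately show ?thesis by simp
  qed
  then have "UNIV - ?H \<subseteq> {..< u * u}" by (auto simp: not_less[symmetric])
  then have "finite (UNIV - ?H)" using finite_subset by blast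
  then show ?thesis
    unfolding numerical_semigroup_def using semigroup_gen_zero semigroup_gen_add by blast
qed

lemma numerical_semigroup_shifted_semigroup:
  assumes "r 0 = 0" "coprime n (Gcd (r ` {1..k}))"
  shows "numerical_semigroup (shifted_semigroup k r n)"
proof -
  let ?g = "Gcd ((\<lambda>i. n + r i) ` {0..k})"
  have dvd: "?g dvd n + r i" if "i \<le> k" for i using that by (intro Gcd_dvd) auto
  have n: "?g dvd n" using dvd[of 0] assms(1) by simp
  have "?g dvd r i" if "i \<le> k" for i using dvd[OF that] n by (simp add: dvd_add_right_iff)
  then have "?g dvd Gcd (r ` {1..k})" by (intro Gcd_greatest) auto
  then have "?g = 1" using n assms(2) by (metis coprime_common_divisor_nat)
  then show ?thesis
    unfolding shifted_semigroup_def by (intro numerical_semigroup_semigroup_gen) auto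
qed

end

theory Submission
  imports Defs "HOL-Number_Theory.Cong"
begin

text \<open>
  Write \<open>H\<close> for the shifted semigroup, \<open>F\<close> for its Frobenius number and \<open>e = r k\<close> for the
  largest shift. If a semigroup is almost symmetric, then \<open>f \<mapsto> F - f\<close> is an involution of the
  pseudo-Frobenius numbers other than \<open>F\<close>; if moreover the type is even, these are odd in number,
  so the involution has a fixed point and \<open>F / 2\<close> is a pseudo-Frobenius number
  (\<open>even_type_half_frobenius\<close>). The theorem therefore follows once \<open>H\<close> is known to have no
  pseudo-Frobenius number near \<open>F / 2\<close>.

  A sum of \<open>l\<close> generators of \<open>H\<close> is \<open>l n + s\<close>, where \<open>s\<close> is a sum of \<open>l\<close> of the numbers
  \<open>0 = r 0, ..., r k\<close>, so \<open>H\<close> is a union of layers, the \<open>l\<close>-th lying in \<open>[l n, l (n + e)]\<close> and in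
  a residue class modulo \<open>d\<close> that depends only on \<open>l\<close> modulo \<open>d\<close>. The layers whose numbers
  agree modulo \<open>d\<close> stay apart until \<open>l\<close> is about \<open>d n / e\<close>, and soon after that point they
  cover everything. Hence \<open>F\<close> is about \<open>d n^2 / e\<close>, and \<open>F / 2\<close> is located where consecutive layers
  of the same class are still far apart, but where \<open>l\<close> is already large. For large \<open>l\<close> the shape
  of a layer is stable: \<open>s\<close> is a sum of \<open>l\<close> shifts as soon as \<open>s\<close> is some sum of shifts and
  \<open>l e - s\<close> is some sum of the opposite shifts \<open>e - r i\<close> (\<open>sums_of_length_stable\<close>).

  Suppose \<open>f\<close> is a pseudo-Frobenius number in this middle range. Then \<open>f + n\<close> and \<open>f + n + e\<close>
  belong to \<open>H\<close>. They are congruent modulo \<open>d\<close> and only \<open>e\<close> apart, so they lie in the same layer: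
  \<open>f + n = l n + s\<close>, where \<open>s\<close> and \<open>s + e\<close> are both sums of \<open>l\<close> shifts. Then \<open>(l - 1) e - s\<close> is a
  sum of opposite shifts, so by stability \<open>s\<close> is already a sum of \<open>l - 1\<close> shifts, and
  \<open>f = (l - 1) n + s\<close> lies in \<open>H\<close>, a contradiction (\<open>no_pseudo_frobenius_in_middle\<close>). The
  hypothesis \<open>n \<ge> e^4\<close> makes the middle range wide enough to contain \<open>F / 2\<close>.
\<close>

section \<open>Half the Frobenius number\<close>

lemma
  assumes "numerical_semigroup H"
  shows frobenius_notin: "frobenius H \<notin> int ` H"
    and le_frobenius: "x \<notin> int ` H \<Longrightarrow> x \<le> frobenius H"
proof -
  let ?G = "insert (- 1) (int ` (UNIV - H))"
  have fin: "finite ?G" using assms by (simp add: numerical_semigroup_def)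
  have in_G: "Max ?G \<in> ?G" using fin by (intro Max_in) auto
  have notin: "Max ?G \<notin> int ` H"
    using in_G by auto
  have max: "x \<le> Max ?G" if "x \<notin> int ` H" for x
  proof (cases "x < 0")
    case True
    then have "x \<le> - 1" by simp
    also have "- 1 \<le> Max ?G" using fin by (intro Max_ge) auto
    finally show ?thesis .
  next
    case False
    then have "x = int (nat x)" by simp
    then have "x \<in> ?G" using that by (metis DiffI UNIV_I image_eqI insertI2)
    then show ?thesis using fin by (intro Max_ge) auto
  qed
  have "frobenius H = Max ?G"
    unfolding frobenius_def by (rule Greatest_equality) (use notin max in auto)
  then show "frobenius H \<notin> int ` H" "x \<notin> int ` H \<Longrightarrow> x \<le> frobenius H"
    using notin max by auto
qed

lemma frobenius_in_pseudo_frobenius: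
  assumes "numerical_semigroup H"
  shows "frobenius H \<in> pseudo_frobenius H"
  using frobenius_notin[OF assms] le_frobenius[OF assms, of "frobenius H + int _"]
  unfolding pseudo_frobenius_def by force

lemma finite_pseudo_frobenius:
  assumes "numerical_semigroup H"
  shows "finite (pseudo_frobenius H)"
proof -
  have "infinite H"
    using assms unfolding numerical_semigroup_def
    by (metis Diff_infinite_finite infinite_UNIV_nat)
  then obtain h where h: "h \<in> H" "h \<noteq> 0"
    by (metis finite.emptyI finite.insertI finite_subset insertCI subsetI)
  have "pseudo_frobenius H \<subseteq> {- int h..frobenius H}"
  proof
    fix x assume x: "x \<in> pseudo_frobenius H"
    then have "x + int h \<in> int ` H" using h unfolding pseudo_frobenius_def by blast
    then have "- int h \<le> x" by auto
    moreover have "x \<le> frobenius H"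
      using x le_frobenius[OF assms] unfolding pseudo_frobenius_def by blast
    ultimately show "x \<in> {- int h..frobenius H}" by simp
  qed
  then show ?thesis by (rule finite_subset) simp
qed

text \<open>
  The number \<open>x = F - f\<close> is in the canonical ideal because \<open>F - x = f\<close> is a gap, and almost
  symmetry then keeps \<open>x + h\<close> in \<open>H\<close>. It is itself a gap, since otherwise
  \<open>F = f + x\<close> would be in \<open>H\<close>.
\<close>

lemma almost_symmetric_reflection:
  assumes "numerical_semigroup H" "almost_symmetric H"
    and f: "f \<in> pseudo_frobenius H" "f \<noteq> frobenius H"
  shows "frobenius H - f \<in> pseudo_frobenius H - {frobenius H}"
proof -
  note F = frobenius_notin[OF assms(1)] le_frobenius[OF assms(1)]
  have fH: "f \<notin> int ` H" and shift: "\<And>h. h \<in> H \<Longrightarrow> h \<noteq> 0 \<Longrightarrow> f + int h \<in> int ` H"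
    using f unfolding pseudo_frobenius_def by auto
  obtain x where x: "frobenius H - f = int x"
    using F(2)[OF fH] by (metis diff_ge_0_iff_ge nonneg_int_cases)
  then have "frobenius H - int x = f" by linarith
  then have "x \<in> canonical_ideal H" using fH unfolding canonical_ideal_def by simp
  then have "h + x \<in> H" if "h \<in> H" "h \<noteq> 0" for h
    using assms(2) that unfolding almost_symmetric_def maximal_ideal_def set_plus_def by blast
  then have "frobenius H - f + int h \<in> int ` H" if "h \<in> H" "h \<noteq> 0" for h
    using that x by (metis add.commute image_eqI of_nat_add)
  moreover have "frobenius H - f \<notin> int ` H"
  proof
    assume "frobenius H - f \<in> int ` H"
    then have "x \<in> H" "x \<noteq> 0" using x f by auto
    then have "f + int x \<in> int ` H" by (rule shift)
    moreover have "f + int x = frobenius H" using x by linarith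
    ultimately show False using F(1) by simp
  qed
  moreover have "f \<noteq> 0" using fH assms(1) unfolding numerical_semigroup_def by force
  ultimately show ?thesis unfolding pseudo_frobenius_def by auto
qed

text \<open>
  Without a fixed point, the reflection would match the pseudo-Frobenius numbers below \<open>F / 2\<close>
  with those above it, other than \<open>F\<close>; together with \<open>F\<close> this would give an odd type.
\<close>

lemma even_type_half_frobenius:
  assumes "numerical_semigroup H" "almost_symmetric H" "even (semigroup_type H)"
  shows "\<exists>f \<in> pseudo_frobenius H. 2 * f = frobenius H"
proof (rule ccontr)
  assume none: "\<not> ?thesis"
  let ?F = "frobenius H"
  let ?P = "pseudo_frobenius H - {?F}"
  let ?L = "{f \<in> ?P. 2 * f < ?F}" and ?G = "{f \<in> ?P. 2 * f > ?F}"
  note fin = finite_pseudo_frobenius[OF assms(1)]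
  have refl: "?F - f \<in> ?P" if "f \<in> ?P" for f
    using almost_symmetric_reflection[OF assms(1,2)] that by blast
  have "bij_betw (\<lambda>f. ?F - f) ?L ?G"
  proof (rule bij_betw_byWitness[where f' = "\<lambda>f. ?F - f"])
    show "(\<lambda>f. ?F - f) ` ?L \<subseteq> ?G" "(\<lambda>f. ?F - f) ` ?G \<subseteq> ?L"
      using refl by (force simp del: Diff_iff)+
  qed auto
  then have "card ?L = card ?G" by (rule bij_betw_same_card)
  moreover have "?L \<union> ?G = ?P" using none by force
  moreover have "card (?L \<union> ?G) = card ?L + card ?G"
    using fin by (intro card_Un_disjoint) auto
  ultimately have "even (card ?P)" by simp
  moreover have "card (pseudo_frobenius H) = Suc (card ?P)"
    using card.remove[OF fin frobenius_in_pseudo_frobenius[OF assms(1)]] .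
  ultimately show False using assms(3) unfolding semigroup_type_def by simp
qed

section \<open>Sums of a prescribed number of steps\<close>

definition sums_of_length :: "nat \<Rightarrow> (nat \<Rightarrow> nat) \<Rightarrow> nat \<Rightarrow> nat set" where
  "sums_of_length k r l = {\<Sum>i\<le>k. c i * r i | c :: nat \<Rightarrow> nat. (\<Sum>i\<le>k. c i) = l}"

text \<open>
  The sequence \<open>e - r k, ..., e - r 0\<close>, again increasing from \<open>0\<close> to \<open>e\<close>. Replacing each shift by
  its opposite turns a sum \<open>s\<close> of \<open>l\<close> shifts into \<open>l e - s\<close>, which exchanges the two ends of a
  layer.
\<close>

definition opposite :: "nat \<Rightarrow> (nat \<Rightarrow> nat) \<Rightarrow> nat \<Rightarrow> nat" where
  "opposite k r i = r k - r (k - i)"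

lemma sums_of_length_add:
  assumes "s \<in> sums_of_length k r l" "t \<in> sums_of_length k r m"
  shows "s + t \<in> sums_of_length k r (l + m)"
proof -
  obtain b c where "s = (\<Sum>i\<le>k. b i * r i)" "(\<Sum>i\<le>k. b i) = l"
      "t = (\<Sum>i\<le>k. c i * r i)" "(\<Sum>i\<le>k. c i) = m"
    using assms unfolding sums_of_length_def by blast
  then show ?thesis unfolding sums_of_length_def
    by (auto intro!: exI[of _ "\<lambda>i. b i + c i"] simp: sum.distrib algebra_simps)
qed

lemma sums_of_length_single:
  assumes "j \<le> k"
  shows "a * r j \<in> sums_of_length k r a"
proof -
  have "(\<Sum>i\<le>k. (if i = j then a else 0) * r i) = (\<Sum>i\<le>k. if i = j then a * r i else 0)"
    by (intro sum.cong) auto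
  then show ?thesis using assms unfolding sums_of_length_def
    by (auto intro!: exI[of _ "\<lambda>i. if i = j then a else 0"])
qed

locale steps =
  fixes k :: nat and r :: "nat \<Rightarrow> nat"
  assumes two_le: "2 \<le> k" and zero: "r 0 = 0" and mono: "strict_mono_on {0..k} r"
begin

abbreviation e :: nat where "e \<equiv> r k"

text \<open>
  An upper bound for the length of a sum of the shifts \<open>r 1, ..., r (k - 1)\<close> in which each occurs
  fewer than \<open>e\<close> times.
\<close>

definition J :: nat where "J = (k - 1) * (e - 1)"

lemma step_le: "i \<le> k \<Longrightarrow> r i \<le> e"
  using strict_mono_on_imp_mono_on[OF mono] by (auto intro: mono_onD)

lemma index_le_step: "i \<le> k \<Longrightarrow> i \<le> r i"
proof (induction i)
  case (Suc i)
  then have "r i < r (Suc i)" by (intro strict_mono_onD[OF mono]) auto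
  then show ?case using Suc by simp
qed simp

lemma k_le_e: "k \<le> e" using index_le_step by simp

lemma two_le_e: "2 \<le> e" using two_le k_le_e by simp

lemma opposite_steps: "steps k (opposite k r)"
proof
  show "strict_mono_on {0..k} (opposite k r)"
  proof (rule strict_mono_onI)
    fix i j assume ij: "i \<in> {0..k}" "j \<in> {0..k}" "i < j"
    then have "r (k - j) < r (k - i)" by (intro strict_mono_onD[OF mono]) auto
    moreover have "r (k - i) \<le> e" by (rule step_le) simp
    ultimately show "opposite k r i < opposite k r j" unfolding opposite_def by linarith
  qed
qed (use two_le in \<open>auto simp: opposite_def\<close>)

lemma opposite_last: "opposite k r k = e"
  by (simp add: opposite_def zero)

lemma opposite_J: "steps.J k (opposite k r) = J"
  by (simp add: steps.J_def[OF opposite_steps] J_def opposite_last)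

lemma opposite_opposite:
  assumes "i \<le> k"
  shows "opposite k (opposite k r) i = r i"
  using assms step_le[OF assms] by (simp add: opposite_def zero)

lemma sums_of_length_le:
  assumes "s \<in> sums_of_length k r l"
  shows "s \<le> l * e"
proof -
  obtain c where c: "s = (\<Sum>i\<le>k. c i * r i)" "(\<Sum>i\<le>k. c i) = l"
    using assms unfolding sums_of_length_def by blast
  have "s \<le> (\<Sum>i\<le>k. c i * e)" unfolding c(1) by (intro sum_mono mult_le_mono2 step_le) auto
  also have "\<dots> = l * e" by (simp add: c(2) flip: sum_distrib_right)
  finally show ?thesis .
qed

lemma sums_of_length_mono:
  assumes "s \<in> sums_of_length k r l" "l \<le> m"
  shows "s \<in> sums_of_length k r m"
  using sums_of_length_add[OF assms(1) sums_of_length_single[of 0 k "m - l" r]] assms(2) zero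
  by simp

lemma opposite_sum:
  assumes "s \<in> sums_of_length k r l"
  shows "l * e - s \<in> sums_of_length k (opposite k r) l"
proof -
  obtain c where c: "s = (\<Sum>i\<le>k. c i * r i)" "(\<Sum>i\<le>k. c i) = l"
    using assms unfolding sums_of_length_def by blast
  have rev: "(\<Sum>i\<le>k. g (k - i)) = (\<Sum>i\<le>k. g i)" for g :: "nat \<Rightarrow> nat"
    by (rule sum.reindex_bij_witness[of _ "\<lambda>i. k - i" "\<lambda>i. k - i"]) auto
  have "(\<Sum>i\<le>k. c (k - i) * opposite k r i) = (\<Sum>i\<le>k. c i * (e - r i))"
    unfolding opposite_def using rev[of "\<lambda>i. c i * (e - r i)"] .
  also have "\<dots> + s = (\<Sum>i\<le>k. c i * e)" unfolding c(1) sum.distrib[symmetric]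
    by (intro sum.cong) (auto simp: step_le simp flip: distrib_left)
  also have "\<dots> = l * e" by (simp add: c(2) flip: sum_distrib_right)
  finally have "l * e - s = (\<Sum>i\<le>k. c (k - i) * opposite k r i)" by simp
  then show ?thesis using c(2) rev[of c] unfolding sums_of_length_def
    by (intro CollectI exI[of _ "\<lambda>i. c (k - i)"]) auto
qed

lemma opposite_sum_iff:
  assumes "s \<le> l * e"
  shows "l * e - s \<in> sums_of_length k (opposite k r) l \<longleftrightarrow> s \<in> sums_of_length k r l"
proof
  assume "l * e - s \<in> sums_of_length k (opposite k r) l"
  then have "l * e - (l * e - s) \<in> sums_of_length k (opposite k (opposite k r)) l"
    using steps.opposite_sum[OF opposite_steps] by (simp add: opposite_last)
  moreover have "sums_of_length k (opposite k (opposite k r)) l = sums_of_length k r l"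
    unfolding sums_of_length_def by (simp add: opposite_opposite)
  ultimately show "s \<in> sums_of_length k r l" using assms by simp
qed (rule opposite_sum)

text \<open>
  A batch of \<open>e\<close> copies of \<open>r i\<close> has the same sum as \<open>r i\<close> copies of \<open>e\<close>. So the multiplicities
  of the inner shifts can be reduced modulo \<open>e\<close>.
\<close>

lemma short_remainder:
  assumes "s \<in> sums_of_length k r m"
  shows "\<exists>a w. s = a * e + w \<and> w \<in> sums_of_length k r J"
proof -
  obtain c where c: "s = (\<Sum>i\<le>k. c i * r i)"
    using assms unfolding sums_of_length_def by blast
  define b where "b i = (if i \<in> {1..<k} then c i mod e else 0)" for i
  let ?w = "\<Sum>i\<le>k. b i * r i"
  have split: "(\<Sum>i\<le>k. g i) = g 0 + (\<Sum>i=1..<k. g i) + g k" for g :: "nat \<Rightarrow> nat"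
  proof -
    have "{..k} = insert 0 (insert k {1..<k})" using two_le by auto
    then show ?thesis using two_le by simp
  qed
  have w: "?w = (\<Sum>i=1..<k. (c i mod e) * r i)" and len: "(\<Sum>i\<le>k. b i) = (\<Sum>i=1..<k. c i mod e)"
    unfolding split by (auto simp: b_def)
  have "s = (\<Sum>i=1..<k. c i * r i) + c k * e" unfolding c split by (simp add: zero)
  also have "(\<Sum>i=1..<k. c i * r i) = (\<Sum>i=1..<k. (c i div e * r i) * e + (c i mod e) * r i)"
  proof (intro sum.cong refl)
    fix i
    have "c i * r i = (c i div e * e + c i mod e) * r i" by simp
    also have "\<dots> = (c i div e * r i) * e + (c i mod e) * r i" by (simp only: algebra_simps)
    finally show "c i * r i = (c i div e * r i) * e + (c i mod e) * r i" .
  qed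
  also have "\<dots> = (\<Sum>i=1..<k. c i div e * r i) * e + ?w"
    by (simp add: sum.distrib w sum_distrib_right)
  finally have "s = ((\<Sum>i=1..<k. c i div e * r i) + c k) * e + ?w"
    by (simp add: algebra_simps)
  moreover have "?w \<in> sums_of_length k r (\<Sum>i\<le>k. b i)" unfolding sums_of_length_def by blast
  moreover have "(\<Sum>i\<le>k. b i) \<le> J"
  proof -
    have "c i mod e \<le> e - 1" for i
      using mod_less_divisor[of e "c i"] two_le_e by linarith
    then have "(\<Sum>i=1..<k. c i mod e) \<le> (\<Sum>i=1..<k. e - 1)" by (intro sum_mono)
    then show ?thesis unfolding len J_def by simp
  qed
  ultimately show ?thesis using sums_of_length_mono by blast
qed

text \<open>
  Write \<open>s = a e + w\<close> and \<open>l e - s = b e + v\<close> with short remainders. If \<open>a + J \<le> l\<close>, the first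
  representation is short enough; if \<open>b + J \<le> l\<close>, the second one is, and passing back to the
  opposite represents \<open>s\<close>. If both failed, then \<open>a + b > 2 (l - J) \<ge> l\<close>, too much for the sum \<open>l e\<close>.
\<close>

lemma sums_of_length_stable:
  assumes "s \<in> sums_of_length k r m" "s \<le> l * e"
    and "l * e - s \<in> sums_of_length k (opposite k r) m'" "2 * J \<le> l"
  shows "s \<in> sums_of_length k r l"
proof (rule ccontr)
  interpret opp: steps k "opposite k r" by (rule opposite_steps)
  assume contra: "s \<notin> sums_of_length k r l"
  obtain a w where a: "s = a * e + w" "w \<in> sums_of_length k r J"
    using short_remainder[OF assms(1)] by blast
  obtain b v where b: "l * e - s = b * e + v" "v \<in> sums_of_length k (opposite k r) J"
    using opp.short_remainder[OF assms(3)] by (auto simp: opposite_last opposite_J)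
  have "s \<in> sums_of_length k r (a + J)"
    unfolding a(1) by (intro sums_of_length_add sums_of_length_single a(2)) simp
  then have "l < a + J" using contra sums_of_length_mono not_less by blast
  moreover have "l * e - s \<in> sums_of_length k (opposite k r) (b + J)"
    using sums_of_length_add[OF sums_of_length_single[of k k b "opposite k r"] b(2)]
    by (simp add: b(1) opposite_last)
  then have "l < b + J"
    using contra opposite_sum_iff[OF assms(2)] opp.sums_of_length_mono not_less by blast
  moreover have "(a + b) * e \<le> l * e" using a(1) b(1) assms(2) by (simp add: algebra_simps)
  then have "a + b \<le> l" using two_le_e by simp
  ultimately show False using assms(4) by linarith
qed

text \<open>
  Far out, every multiple of the gcd is a sum of shifts. Adding a large multiple of \<open>e\<close> to \<open>s\<close>
  reaches that region; the short remainder of the resulting sum is congruent to \<open>s\<close> modulo \<open>e\<close>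
  and at most \<open>J e \<le> s\<close>, so the copies of \<open>e\<close> that were added can be removed again.
\<close>

lemma multiple_of_Gcd_is_sum:
  assumes "Gcd (r ` {1..k}) dvd s" "J * e \<le> s"
  shows "\<exists>m. s \<in> sums_of_length k r m"
proof -
  let ?d = "Gcd (r ` {1..k})"
  have dvd: "?d dvd r i" if "i \<in> {1..k}" for i using that by auto
  have "?d dvd e" using dvd two_le by simp
  then have "?d > 0" using two_le_e by (metis dvd_pos_nat gr0I not_numeral_le_zero)
  define A where "A = (\<lambda>i. r i div ?d) ` {1..k}"
  have "r ` {1..k} = (*) ?d ` A" unfolding A_def image_image using dvd by (intro image_cong) auto
  then have "?d = ?d * Gcd A" by (metis Gcd_mult normalize_nat_def id_apply)
  then have "Gcd A = 1" using \<open>?d > 0\<close> by (metis mult_cancel_left nat_mult_1_right less_irrefl)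
  then have "finite (UNIV - semigroup_gen A)"
    using numerical_semigroup_semigroup_gen[of A] unfolding numerical_semigroup_def A_def by simp
  then obtain N where N: "\<And>x. x > N \<Longrightarrow> x \<in> semigroup_gen A"
    by (metis DiffI UNIV_I finite_nat_set_iff_bounded_le not_le)
  obtain q where q: "s = ?d * q" using assms(1) by blast
  obtain e' where e': "e = ?d * e'" using \<open>?d dvd e\<close> by blast
  have "e' > 0" using e' two_le_e by (intro gr0I) auto
  define t where "t = q + Suc N * e'"
  have "N < Suc N * e'" using \<open>e' > 0\<close> by (cases e') auto
  then have "t \<in> semigroup_gen A" unfolding t_def by (intro N trans_less_add2)
  then obtain l where l: "t = (\<Sum>a\<in>A. l a * a)" unfolding semigroup_gen_def by blast
  have "\<exists>m. ?d * x \<in> sums_of_length k r m" if "x \<in> A" for x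
  proof -
    obtain i where i: "i \<in> {1..k}" "x = r i div ?d" using \<open>x \<in> A\<close> unfolding A_def by blast
    then have "?d * x = 1 * r i" using dvd by simp
    then show ?thesis using sums_of_length_single[of i k 1 r] i by auto
  qed
  note elem = this
  have mult: "\<exists>m. n * x \<in> sums_of_length k r m" if "x \<in> sums_of_length k r m'" for n x m'
  proof (induction n)
    case 0
    then show ?case using sums_of_length_single[of 0 k 0 r] by auto
  next
    case (Suc n)
    then show ?case using that sums_of_length_add by fastforce
  qed
  have "\<exists>m. ?d * (\<Sum>a\<in>B. l a * a) \<in> sums_of_length k r m" if "finite B" "B \<subseteq> A" for B
    using that
  proof (induction B)
    case empty
    then show ?case using sums_of_length_single[of 0 k 0 r] by auto
  next
    case (insert x B)
    obtain m1 where "l x * (?d * x) \<in> sums_of_length k r m1"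
      using elem mult insert.prems by (meson insert_subset)
    moreover obtain m2 where "?d * (\<Sum>a\<in>B. l a * a) \<in> sums_of_length k r m2"
      using insert by blast
    ultimately have "l x * (?d * x) + ?d * (\<Sum>a\<in>B. l a * a) \<in> sums_of_length k r (m1 + m2)"
      by (rule sums_of_length_add)
    then show ?case using insert.hyps by (auto simp: algebra_simps)
  qed
  from this[of A] obtain m where "?d * t \<in> sums_of_length k r m"
    unfolding l A_def by auto
  then obtain a w where a: "?d * t = a * e + w" "w \<in> sums_of_length k r J"
    using short_remainder by blast
  have t: "?d * t = s + Suc N * e" unfolding t_def q e' by (simp only: algebra_simps)
  have w: "w \<le> s" using sums_of_length_le[OF a(2)] assms(2) by simp
  have "Suc N * e \<le> a * e" using a(1) t w by linarith
  then have "s = (a - Suc N) * e + w" using a(1) t unfolding diff_mult_distrib by linarith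
  then show ?thesis
    using sums_of_length_add[OF sums_of_length_single[of k k "a - Suc N" r] a(2)] by auto
qed

text \<open>
  The two gcds are in fact equal; this direction lets the previous lemma be applied to the opposite
  sequence with the gcd of the original one.
\<close>

lemma Gcd_opposite_dvd: "Gcd (opposite k r ` {1..k}) dvd Gcd (r ` {1..k})"
proof (rule Gcd_greatest)
  let ?g = "Gcd (opposite k r ` {1..k})"
  have dvd: "?g dvd opposite k r i" if "i \<in> {1..k}" for i using that by auto
  fix x assume "x \<in> r ` {1..k}"
  then obtain i where i: "i \<in> {1..k}" "x = r i" by blast
  have e: "?g dvd e" using dvd[of k] two_le opposite_last by simp
  show "?g dvd x"
  proof (cases "i = k")
    case False
    then have "?g dvd e - r i" using dvd[of "k - i"] i by (auto simp: opposite_def)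
    then show ?thesis using e step_le[of i] i by (metis atLeastAtMost_iff dvd_diffD1)
  qed (use e i in simp)
qed

lemma central_multiple_is_sum:
  assumes "Gcd (r ` {1..k}) dvd s" "J * e \<le> s" "s + J * e \<le> l * e"
  shows "s \<in> sums_of_length k r l"
proof -
  interpret opp: steps k "opposite k r" by (rule opposite_steps)
  have "Gcd (r ` {1..k}) dvd e" using two_le by (intro Gcd_dvd) auto
  then have "Gcd (r ` {1..k}) dvd l * e - s" using assms(1) by (intro dvd_diff_nat dvd_mult)
  then have "Gcd (opposite k r ` {1..k}) dvd l * e - s" using Gcd_opposite_dvd dvd_trans by blast
  moreover have "J * e \<le> l * e - s" using assms(3) by linarith
  ultimately obtain m' where "l * e - s \<in> sums_of_length k (opposite k r) m'"
    using opp.multiple_of_Gcd_is_sum[of "l * e - s"] unfolding opposite_last opposite_J by blast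
  moreover obtain m where "s \<in> sums_of_length k r m"
    using multiple_of_Gcd_is_sum[OF assms(1,2)] by blast
  moreover have "2 * J * e \<le> l * e" using assms by linarith
  then have "2 * J \<le> l" using two_le_e by simp
  ultimately show ?thesis using sums_of_length_stable assms(3) by (meson add_leE)
qed

section \<open>Layers of the shifted semigroup\<close>

lemma mem_shifted_semigroup_iff:
  "x \<in> shifted_semigroup k r n \<longleftrightarrow> (\<exists>l s. s \<in> sums_of_length k r l \<and> x = l * n + s)"
proof -
  have inj: "inj_on (\<lambda>i. n + r i) {..k}"
    using strict_mono_on_imp_inj_on[OF mono] by (auto simp: inj_on_def)
  have expand: "(\<Sum>i\<le>k. c i * (n + r i)) = (\<Sum>i\<le>k. c i) * n + (\<Sum>i\<le>k. c i * r i)"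
    for c :: "nat \<Rightarrow> nat"
    by (simp add: algebra_simps sum.distrib sum_distrib_left)
  have "x \<in> shifted_semigroup k r n \<longleftrightarrow> (\<exists>c. x = (\<Sum>i\<le>k. c i * (n + r i)))"
  proof
    assume "x \<in> shifted_semigroup k r n"
    then show "\<exists>c. x = (\<Sum>i\<le>k. c i * (n + r i))"
      unfolding shifted_semigroup_def semigroup_gen_def atLeast0AtMost
      by (auto simp: sum.reindex[OF inj])
  next
    assume "\<exists>c. x = (\<Sum>i\<le>k. c i * (n + r i))"
    then obtain c where "x = (\<Sum>i\<le>k. c i * (n + r i))" by blast
    also have "\<dots> = (\<Sum>a\<in>(\<lambda>i. n + r i) ` {..k}. c (the_inv_into {..k} (\<lambda>i. n + r i) a) * a)"
      by (auto simp: sum.reindex[OF inj] the_inv_into_f_f[OF inj])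
    finally show "x \<in> shifted_semigroup k r n"
      unfolding shifted_semigroup_def semigroup_gen_def atLeast0AtMost
      by (intro CollectI exI conjI TrueI)
  qed
  then show ?thesis unfolding expand sums_of_length_def by blast
qed

text \<open>
  The residue of \<open>x\<close> modulo \<open>d\<close> prescribes \<open>l\<close> modulo \<open>d\<close>. One of \<open>d\<close> consecutive candidates for
  \<open>l\<close> has the right residue, which leaves \<open>x - l n\<close> in a window of length \<open>d n\<close>, here starting
  at \<open>J e\<close>. The condition on \<open>Q\<close> says that the central part of layer \<open>Q\<close>, on which all multiples
  of \<open>d\<close> occur, is at least as long as that window.
\<close>

lemma large_mem_shifted_semigroup:
  assumes "d = Gcd (r ` {1..k})" "coprime n d" "n > 0"
    and Q: "2 * J * e + d * n \<le> Q * e"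
    and x: "J * e + (Q + d) * n \<le> x"
  shows "x \<in> shifted_semigroup k r n"
proof -
  have "d dvd e" unfolding assms(1) using two_le by (intro Gcd_dvd) auto
  then have "d > 0" using two_le_e by (metis dvd_pos_nat gr0I not_numeral_le_zero)
  define y where "y = x - J * e"
  have y: "x = J * e + y" using x unfolding y_def by simp
  define q where "q = y div n"
  have q: "Q + d \<le> q" using x assms(3) unfolding q_def y by (simp add: less_eq_div_iff_mult_less_eq)
  obtain z where "[n * z = 1] (mod d)" using cong_solve_coprime_nat[OF assms(2)] by auto
  then have "[n * z * x = 1 * x] (mod d)" by (rule cong_scalar_right)
  then have "[n * (z * x mod d) = x] (mod d)" by (simp add: cong_def mod_mult_right_eq mult.assoc)
  then obtain u where u: "[n * u = x] (mod d)" "u < d"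
    using \<open>d > 0\<close> mod_less_divisor by blast
  define l where "l = q - (q - u) mod d"
  have mod: "(q - u) mod d < d" using \<open>d > 0\<close> by simp
  have l: "l \<le> q" "q < l + d" "Q \<le> l" using mod q unfolding l_def by linarith+
  have "l = u + (q - u) div d * d"
    unfolding l_def using q u(2) mod div_mult_mod_eq[of "q - u" d] by linarith
  then have "[l = u] (mod d)" by (simp add: cong_def)
  then have lx: "[l * n = x] (mod d)" using u(1)
    by (metis cong_scalar_right cong_trans mult.commute)
  have "l * n \<le> q * n" using l(1) by simp
  moreover have "q * n \<le> y" unfolding q_def by simp
  ultimately have lny: "l * n \<le> y" by linarith
  have "y < (q + 1) * n" using assms(3) unfolding q_def
    by (metis dividend_less_div_times add.commute distrib_right mult_1)
  also have "\<dots> \<le> (l + d) * n" using l(2) by (intro mult_le_mono1) simp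
  finally have yl: "y < l * n + d * n" by (simp add: algebra_simps)
  define s where "s = x - l * n"
  have s: "x = l * n + s" using lny y unfolding s_def by simp
  have "d dvd s" using lx lny y unfolding s_def
    by (metis cong_sym cong_altdef_nat trans_le_add2)
  moreover have "J * e \<le> s" using s y lny by linarith
  moreover have "s + J * e \<le> l * e"
  proof -
    have "Q * e \<le> l * e" using l(3) by simp
    then show ?thesis using s y yl Q by linarith
  qed
  ultimately have "s \<in> sums_of_length k r l" using central_multiple_is_sum assms(1) by blast
  then show ?thesis using s mem_shifted_semigroup_iff by blast
qed

text \<open>The layers \<open>m\<close> and \<open>m + 1\<close> leave a hole between them while \<open>m e\<close> is small against \<open>n\<close>.\<close>

lemma gap_shifted_semigroup:
  assumes "m * (n + e) < x" "x < (m + 1) * n"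
  shows "x \<notin> shifted_semigroup k r n"
proof
  assume "x \<in> shifted_semigroup k r n"
  then obtain l s where ls: "s \<in> sums_of_length k r l" "x = l * n + s"
    using mem_shifted_semigroup_iff by blast
  show False
  proof (cases "l \<le> m")
    case True
    have "x \<le> l * (n + e)" using sums_of_length_le[OF ls(1)] ls(2) by (simp add: algebra_simps)
    also have "\<dots> \<le> m * (n + e)" using True by simp
    finally show False using assms by simp
  next
    case False
    then have "(m + 1) * n \<le> l * n" by (intro mult_le_mono1) simp
    then show False using assms(2) ls(2) by simp
  qed
qed

lemma sum_dvd:
  assumes "s \<in> sums_of_length k r l"
  shows "Gcd (r ` {1..k}) dvd s"
proof -
  obtain c where "s = (\<Sum>i\<le>k. c i * r i)" using assms unfolding sums_of_length_def by blast
  moreover have "Gcd (r ` {1..k}) dvd r i" if "i \<le> k" for i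
    using that zero by (cases "i = 0") auto
  ultimately show ?thesis by (auto intro!: dvd_sum)
qed

text \<open>
  The lower bound forces \<open>f + n\<close> into layers beyond \<open>2 J\<close>, where their shape is stable. The
  upper bound says that layer \<open>l\<close> ends more than \<open>e\<close> before layer \<open>l + d\<close> begins.
\<close>

lemma no_pseudo_frobenius_in_middle:
  assumes "d = Gcd (r ` {1..k})" "coprime n d" "n > 0"
    and f: "f \<in> pseudo_frobenius (shifted_semigroup k r n)"
    and low: "2 * int J * (int n + int e) < f + int n"
    and high: "\<And>l. int l * int n \<le> f + int n \<Longrightarrow> (l + 1) * e < d * n"
  shows False
proof -
  let ?H = "shifted_semigroup k r n"
  have fH: "f \<notin> int ` ?H" and shift: "\<And>h. h \<in> ?H \<Longrightarrow> h \<noteq> 0 \<Longrightarrow> f + int h \<in> int ` ?H"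
    using f unfolding pseudo_frobenius_def by auto
  have gen: "n + r i \<in> ?H" if "i \<le> k" for i
    using sums_of_length_single[OF that, of 1 r] mem_shifted_semigroup_iff
    by (metis mult_1)
  have "f + int n \<in> int ` ?H" using shift[of n] gen[of 0] zero assms(3) by simp
  then obtain l s where ls: "s \<in> sums_of_length k r l" "f + int n = int (l * n + s)"
    using mem_shifted_semigroup_iff by auto
  have "f + int (n + e) \<in> int ` ?H" using assms(3) by (intro shift gen) auto
  then obtain l' s' where ls': "s' \<in> sums_of_length k r l'" "f + int (n + e) = int (l' * n + s')"
    using mem_shifted_semigroup_iff by auto
  note s = sums_of_length_le[OF ls(1)] and s' = sums_of_length_le[OF ls'(1)]
  have eq: "l * n + s + e = l' * n + s'"
    using ls(2) ls'(2) by linarith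
  have le: "(l + 1) * e < d * n" by (rule high) (simp add: ls(2))
  have de: "d dvd e" unfolding assms(1) using two_le by (intro Gcd_dvd) auto
  have "[l * n = l' * n] (mod d)"
  proof -
    have "[l * n + 0 = l * n + (s + e)] (mod d)"
      using sum_dvd[OF ls(1)] de by (intro cong_add) (auto simp: assms(1) cong_0_iff cong_sym_eq[of 0])
    moreover have "[l' * n + 0 = l' * n + s'] (mod d)"
      using sum_dvd[OF ls'(1)] by (intro cong_add) (auto simp: assms(1) cong_0_iff cong_sym_eq[of 0])
    ultimately show ?thesis using eq unfolding cong_def by (metis add.assoc add_0_right)
  qed
  then have cong: "[l = l'] (mod d)" using assms(2) by (simp add: cong_mult_rcancel_nat)
  \<comment> \<open>Distinct layers of the same class are more than \<open>e\<close> apart, so a step of \<open>e\<close> stays in one.\<close>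
  have "l' = l"
  proof (rule ccontr)
    assume "l' \<noteq> l"
    then consider "l + d \<le> l'" | "l' + d \<le> l"
    proof -
      have "int d dvd int l - int l'" using cong by (simp add: cong_iff_dvd_diff flip: cong_int_iff)
      then have "int d \<le> \<bar>int l - int l'\<bar>" using \<open>l' \<noteq> l\<close> by (intro zdvd_imp_le) auto
      then show thesis using that by linarith
    qed
    then show False
    proof cases
      case 1
      then have "(l + d) * n \<le> l' * n" by (intro mult_le_mono1)
      then show False using eq s le by (simp add: algebra_simps)
    next
      case 2
      then have "(l' + d) * n \<le> l * n" "l' * e \<le> l * e" by (intro mult_le_mono1; simp)+
      then show False using eq s' le unfolding distrib_right by linarith
    qed
  qed
  then have s_e: "s + e \<in> sums_of_length k r l" using eq ls'(1) by simp
  have long: "2 * J < l"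
  proof (rule ccontr)
    assume "\<not> ?thesis"
    then have "l * (n + e) \<le> 2 * J * (n + e)" by (intro mult_le_mono1) simp
    then have "l * n + s \<le> 2 * J * (n + e)" using s by (simp add: algebra_simps)
    then have "int (l * n + s) \<le> int (2 * J * (n + e))" by (rule of_nat_mono)
    moreover have "int (2 * J * (n + e)) = 2 * int J * (int n + int e)" by simp
    ultimately show False using low ls(2) by linarith
  qed
  then obtain p where p: "l = Suc p" by (cases l) auto
  have sp: "s \<le> p * e" using sums_of_length_le[OF s_e] p by simp
  have "p * e - s \<in> sums_of_length k (opposite k r) l"
    using opposite_sum[OF s_e] p by simp
  then have "s \<in> sums_of_length k r p"
    using sums_of_length_stable[OF ls(1) sp] long p by simp
  then have "p * n + s \<in> ?H" using mem_shifted_semigroup_iff by blast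
  moreover have "f = int (p * n + s)" using ls(2) p by simp
  ultimately show False using fH by blast
qed

end

theorem proposition4p3:
  fixes k n d :: nat and r :: "nat \<Rightarrow> nat"
  assumes "k \<ge> 2"
    and "r 0 = 0"
    and "strict_mono_on {0..k} r"
    and "d = Gcd (r ` {1..k})"
    and "n > 0"
    and "coprime n d"
    and "n \<ge> r k ^ 4"
  shows "\<not> (almost_symmetric (shifted_semigroup k r n) \<and>
             even (semigroup_type (shifted_semigroup k r n)))"
proof
  interpret steps k r using assms by unfold_locales auto
  let ?H = "shifted_semigroup k r n"
  assume as: "almost_symmetric ?H \<and> even (semigroup_type ?H)"
  have num: "numerical_semigroup ?H"
    using numerical_semigroup_shifted_semigroup assms by simp
  obtain f where f: "f \<in> pseudo_frobenius ?H" "2 * f = frobenius ?H"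
    using even_type_half_frobenius[OF num] as by blast
  have "d dvd e" unfolding assms(4) using assms(1) by (intro Gcd_dvd) auto
  then have "d > 0" using two_le_e by (metis dvd_pos_nat gr0I not_numeral_le_zero)
  \<comment> \<open>With \<open>e = t + 2\<close> both estimates below become comparisons of coefficients of polynomials in \<open>t\<close>.
     The second is an equality for \<open>e = 2\<close>, \<open>d = 1\<close>, \<open>n = 16\<close>, so no constant in it can be relaxed.\<close>
  obtain t where t: "e = t + 2" using two_le_e by (metis add.commute le_Suc_ex)
  have J: "J \<le> (t + 1) * (t + 1)" 
    unfolding J_def using k_le_e t by (intro mult_le_mono) auto
  have Jlow: "4 * J * e + 1 < n"
  proof -
    have "4 * J * e + 1 \<le> 4 * ((t + 1) * (t + 1)) * (t + 2) + 1"
      by (intro add_mono mult_le_mono J) (auto simp: t)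
    also have "\<dots> < (t + 2) ^ 4" by (simp add: eval_nat_numeral algebra_simps)
    also have "\<dots> \<le> n" using assms(7) t by simp
    finally show ?thesis .
  qed
  have Jhigh: "(2 * J + d + 5) * e \<le> d * n"
  proof -
    obtain c where c: "d = c + 1" using \<open>d > 0\<close> by (metis Suc_eq_plus1 gr0_conv_Suc)
    have "2 * J + d + 5 \<le> 2 * ((t + 1) * (t + 1)) + d + 5" using J by simp
    also have "\<dots> \<le> d * (t + 2) ^ 3" unfolding c by (simp add: eval_nat_numeral algebra_simps)
    finally have "(2 * J + d + 5) * e \<le> d * (t + 2) ^ 3 * e" by (rule mult_le_mono1)
    also have "\<dots> = d * e ^ 4" 
      unfolding t[symmetric] by (simp add: power4_eq_xxxx power3_eq_cube)
    also have "\<dots> \<le> d * n" using assms(7) by simp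
    finally show ?thesis .
  qed
  \<comment> \<open>The first hole after layer \<open>4 J\<close> bounds \<open>F\<close> from below, so half of \<open>F\<close> is beyond layer \<open>2 J\<close>.\<close>
  have "4 * j * (n + e) + 1 \<notin> ?H" if "4 * j * e + 1 < n" for j
    using that by (intro gap_shifted_semigroup[of "4 * j"]) (simp_all add: algebra_simps)
  from this[OF Jlow] have "4 * J * (n + e) + 1 \<notin> ?H" .
  then have "int (4 * J * (n + e) + 1) \<notin> int ` ?H" by (simp only: inj_image_mem_iff[OF inj_of_nat] not_False_eq_True)
  then have low: "int (4 * J * (n + e) + 1) \<le> 2 * f"
    unfolding f(2) by (rule le_frobenius[OF num])
  \<comment> \<open>\<open>Q\<close> is \<open>2 J\<close> plus \<open>d n / e\<close> rounded up.\<close>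
  define Q where "Q = 2 * J + (d * n + (e - 1)) div e"
  have div: "(d * n + (e - 1)) div e * e \<le> d * n + (e - 1)"
      "d * n \<le> (d * n + (e - 1)) div e * e"
    using div_mult_mod_eq[of "d * n + (e - 1)" e] mod_less_divisor[of e "d * n + (e - 1)"] two_le_e
    by linarith+
  have Q1: "2 * J * e + d * n \<le> Q * e"
    unfolding Q_def distrib_right using div(2) by linarith
  have Q2: "Q * e < 2 * J * e + d * n + e"
    unfolding Q_def distrib_right using div(1) two_le_e by linarith
  have up: "2 * f < int (J * e + (Q + d) * n)"
  proof (rule ccontr)
    assume "\<not> ?thesis"
    then obtain x where x: "2 * f = int x" "J * e + (Q + d) * n \<le> x"
      by (metis linorder_not_less nat_int_comparison(3) of_nat_0_le_iff order_trans zero_le_imp_eq_int)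
    have "x \<in> ?H" by (rule large_mem_shifted_semigroup[OF assms(4,6,5) Q1 x(2)])
    then have "frobenius ?H \<in> int ` ?H" using f(2) x(1) by (metis image_eqI)
    then show False using frobenius_notin[OF num] by contradiction
  qed
  show False
  proof (rule no_pseudo_frobenius_in_middle[OF assms(4,6,5) f(1)])
    have "int (4 * J * (n + e) + 1) = 2 * (2 * int J * (int n + int e)) + 1" by simp
    then show "2 * int J * (int n + int e) < f + int n" using low by linarith
  next
    fix l assume "int l * int n \<le> f + int n"
    then have "int (2 * (l * n)) \<le> 2 * f + int (2 * n)" by simp
    then have "int (2 * (l * n)) < int (J * e + (Q + d) * n) + int (2 * n)" using up by linarith
    then have "2 * (l * n) < J * e + (Q + d) * n + 2 * n" by linarith
    also have "\<dots> < (Q + d + 3) * n" using Jlow by (simp add: algebra_simps)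
    finally have "(2 * l) * n < (Q + d + 3) * n" by simp
    then have "2 * l < Q + d + 3" by (simp only: mult_less_cancel2)
    then have "2 * (l + 1) \<le> Q + d + 4" by simp
    then have "2 * (l + 1) * e \<le> (Q + d + 4) * e" by (rule mult_le_mono1)
    also have "\<dots> < (2 * J + d + 5) * e + d * n" using Q2 by (simp add: algebra_simps)
    finally have "2 * ((l + 1) * e) < (2 * J + d + 5) * e + d * n" by simp
    then show "(l + 1) * e < d * n" using Jhigh
      by linarith
  qed
qed

end
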